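(* Let $\alpha\in(0,2)$ and let $\sigma:\mathbb{R}\to\mathbb{R}$ satisfy $|\sigma(\cdot)|^\alpha\in C^2(\mathbb{R})$, $\sigma(x)\neq0$ for all $x$, and $|\sigma(x)|\le\widetilde M$ for a constant $\widetilde M$. Let $\tilde L\gg 1$, $h>0$ with $J=\tilde L/h\in\mathbb{N}$, $x_j=jh$, $\Delta t>0$, $c(x)=c(1,\alpha)|\sigma(x)|^\alpha$, and consider the explicit Euler scheme for the natural (far-field) condition (with $f=g=0$): for $|j|<J$, $n\ge0$, $$U_j^{n+1}=U_j^n-\Delta t\,c(x_j)\zeta(\alpha-1)h^{-\alpha}\big(U_{j+1}^n-2U_j^n+U_{j-1}^n\big)+c(x_j)\Delta t\,h\sum_{k=-J-j,\,k\ne0}^{J-j}\frac{U_{j+k}^n-U_j^n}{|x_k|^{1+\alpha}} .$$ If $$\frac{\Delta t}{h^\alpha}\le\frac{1}{2\widetilde M^\alpha c(1,\alpha)\big[1+\frac1\alpha-\zeta(\alpha-1)\big]},$$ then the scheme satisfies the discrete maximum principle: with $M$ the maximum of the initial data, if $0<U_j^n\le M$ for all $|j|\le J$, then $U_j^{n+1}\le M$ for all $|j|<J$.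
   Context: $c(1,\alpha)=\dfrac{\alpha\Gamma((1+\alpha)/2)}{2^{1-\alpha}\pi^{1/2}\Gamma(1-\alpha/2)}$; $\zeta$ is the Riemann zeta function (analytically continued). In the sum $\sum_{k=-J-j,k\neq 0}^{J-j}$, the terms of both end indices $k=-J-j$ and $k=J-j$ are multiplied by $\frac12$. The scheme discretizes $u_t(x,t)=c(1,\alpha)|\sigma(x)|^\alpha\,\mathrm{P.V.}\int_{\mathbb{R}\setminus\{0\}}\frac{u(x+z,t)-u(x,t)}{|z|^{1+\alpha}}dz$ on $\mathbb{R}$, truncated to the computational domain $(-\tilde L,\tilde L)$; here $u=|\sigma|^\alpha p$, where $p$ solves the Fokker-Planck equation of $dX_t=\sigma(X_{t-})dL_t^\alpha$. *)

theory Defs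
  imports "HOL-Complex_Analysis.Complex_Analysis"
begin

text \<open>
  The Riemann zeta function, as the analytic continuation of its Dirichlet series: the value
  at \<open>s \<noteq> 1\<close> is that of the continuation to some punctured half-plane
  \<open>{z. a < Re z} - {1}\<close> containing \<open>s\<close>. These domains are connected and nested, so any two
  continuations agree where both are defined; in particular this is the value of the
  continuation to the whole of \<open>-{1}\<close> (see \<open>riemann_zeta_eq_global\<close>).
\<close>

definition zeta_continuation :: "real \<Rightarrow> (complex \<Rightarrow> complex) \<Rightarrow> bool" where
  "zeta_continuation a f \<longleftrightarrow>
     f holomorphic_on ({z. a < Re z} - {1}) \<and>
     (\<forall>z. 1 < Re z \<longrightarrow> (\<lambda>n. 1 / of_nat (Suc n) powr z) sums f z)"

definition riemann_zeta :: "complex \<Rightarrow> complex" where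
  "riemann_zeta s = (THE w. \<exists>a f. a < Re s \<and> zeta_continuation a f \<and> w = f s)"

lemma zeta_continuation_unique:
  assumes f: "zeta_continuation a f" "a < Re s" and g: "zeta_continuation b g" "b < Re s"
    and s: "s \<noteq> 1"
  shows "f s = g s"
proof -
  define c where "c = max a b"
  let ?D = "{z. c < Re z} - {1::complex}" and ?E = "{z. max 1 c < Re z}"
  have "?E \<noteq> {}"
    by (metis (mono_tags, lifting) Re_complex_of_real empty_iff gt_ex mem_Collect_eq)
  moreover have "connected ?D"
    by (intro connected_open_delete convex_connected)
      (auto simp: open_halfspace_Re_gt convex_halfspace_Re_gt)
  moreover have "f holomorphic_on ?D" "g holomorphic_on ?D"
    using f(1) g(1) unfolding zeta_continuation_def c_def
    by (auto elim!: holomorphic_on_subset)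
  moreover have "f z = g z" if "z \<in> ?E" for z
    using f(1) g(1) that unfolding zeta_continuation_def by (auto intro: sums_unique2)
  moreover have "open ?E" "open ?D"
    by (intro open_delete open_halfspace_Re_gt)+
  moreover have "?E \<subseteq> ?D" by auto
  moreover have "s \<in> ?D" using f(2) g(2) s by (auto simp: c_def)
  ultimately show ?thesis
    using analytic_continuation_open[of ?E ?D f g s] by blast
qed

lemma riemann_zeta_eqI:
  assumes "zeta_continuation a f" "a < Re s" "s \<noteq> 1"
  shows "riemann_zeta s = f s"
  unfolding riemann_zeta_def
  using assms zeta_continuation_unique by (intro the_equality) blast+

lemma riemann_zeta_eq_global:
  assumes "f holomorphic_on -{1}"
    and "\<And>z. 1 < Re z \<Longrightarrow> (\<lambda>n. 1 / of_nat (Suc n) powr z) sums f z"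
    and "s \<noteq> 1"
  shows "riemann_zeta s = f s"
proof -
  have "zeta_continuation (Re s - 1) f"
    unfolding zeta_continuation_def using assms(1,2) by (auto elim!: holomorphic_on_subset)
  then show ?thesis using assms(3) by (intro riemann_zeta_eqI) auto
qed

text \<open>
  On the real axis away from \<open>1\<close> the zeta function is real, so taking the real part
  loses nothing.
\<close>

definition real_zeta :: "real \<Rightarrow> real" where
  "real_zeta s = Re (riemann_zeta (of_real s))"

definition twice_cont_diff :: "(real \<Rightarrow> real) \<Rightarrow> bool" where
  "twice_cont_diff f \<longleftrightarrow>
     (\<exists>f' f''. (\<forall>x. (f has_real_derivative f' x) (at x)) \<and>
              (\<forall>x. (f' has_real_derivative f'' x) (at x)) \<and>
              continuous_on UNIV f'')"

text \<open>The constant \<open>c(1,\<alpha>)\<close> of the one-dimensional fractional Laplacian.\<close>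

definition levy_const :: "real \<Rightarrow> real" where
  "levy_const \<alpha> =
     \<alpha> * Gamma ((1 + \<alpha>) / 2) / (2 powr (1 - \<alpha>) * sqrt pi * Gamma (1 - \<alpha> / 2))"

definition levy_coeff :: "real \<Rightarrow> (real \<Rightarrow> real) \<Rightarrow> real \<Rightarrow> real" where
  "levy_coeff \<alpha> \<sigma> x = levy_const \<alpha> * \<bar>\<sigma> x\<bar> powr \<alpha>"

definition grid :: "real \<Rightarrow> int \<Rightarrow> real" where
  "grid h j = of_int j * h"

text \<open>
  The trapezoidal sum over the offsets \<open>k = -J-j, \<dots>, J-j\<close>, \<open>k \<noteq> 0\<close>; the terms
  of both end indices carry the weight \<open>1/2\<close>.
\<close>

definition nonlocal_sum :: "real \<Rightarrow> real \<Rightarrow> nat \<Rightarrow> (int \<Rightarrow> real) \<Rightarrow> int \<Rightarrow> real" where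
  "nonlocal_sum \<alpha> h J V j =
     (\<Sum>k \<in> {- int J - j .. int J - j} - {0}.
        (if k = - int J - j \<or> k = int J - j then 1 / 2 else 1) *
        ((V (j + k) - V j) / \<bar>grid h k\<bar> powr (1 + \<alpha>)))"

text \<open>
  \<open>U n j\<close> is the value at time level \<open>n\<close> and grid point \<open>j\<close>; only \<open>\<bar>j\<bar> \<le> J\<close> matters.
  The scheme updates the interior points \<open>\<bar>j\<bar> < J\<close>.
\<close>

definition explicit_euler_scheme ::
  "real \<Rightarrow> (real \<Rightarrow> real) \<Rightarrow> real \<Rightarrow> real \<Rightarrow> nat \<Rightarrow> (nat \<Rightarrow> int \<Rightarrow> real) \<Rightarrow> bool" where
  "explicit_euler_scheme \<alpha> \<sigma> h dt J U \<longleftrightarrow>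
     (\<forall>n j. \<bar>j\<bar> < int J \<longrightarrow>
        U (Suc n) j =
          U n j
          - dt * levy_coeff \<alpha> \<sigma> (grid h j) * real_zeta (\<alpha> - 1) * h powr (- \<alpha>)
            * (U n (j + 1) - 2 * U n j + U n (j - 1))
          + levy_coeff \<alpha> \<sigma> (grid h j) * dt * h * nonlocal_sum \<alpha> h J (U n) j)"

end

theory Submission
  imports Defs
begin

text \<open>
  Rewriting the scheme as \<open>U\<^sub>j\<^sup>n\<^sup>+\<^sup>1 = (1 - a) U\<^sub>j\<^sup>n + \<dots>\<close>, where the
  remaining weights sum to \<open>a\<close>, the maximum principle follows once these weights are nonnegative
  and \<open>a \<le> 1\<close>. Nonnegativity is the fact that \<open>\<zeta> < 0\<close> on \<open>(-1, 1)\<close>; then \<open>a \<le> 1\<close> is the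
  step size restriction combined with \<open>\<Sum>k\<ge>1. k\<^sup>-\<^sup>1\<^sup>-\<^sup>\<alpha> \<le> 1 + 1/\<alpha>\<close>.

  The sign of \<open>\<zeta>\<close> is read off the first-order Euler-Maclaurin formula: for \<open>Re s > -1\<close>,
  \<open>\<zeta>(s) = 1/(s-1) + 1/2 + \<Sum>\<^sub>n E\<^sub>n(s)\<close>, where \<open>E\<^sub>n(s)\<close> is the error of the trapezoidal rule for
  \<open>x\<^sup>-\<^sup>s\<close> on \<open>[n, n+1]\<close>. For \<open>s \<in> (-1, 0]\<close> the integrand is concave and the errors are
  nonpositive; for \<open>s \<in> (0, 1)\<close> it is decreasing and the errors sum to at most \<open>1/2\<close>.
\<close>

section \<open>Trapezoidal errors and the continuation of zeta\<close>

text \<open>Index \<open>n\<close> belongs to the interval from \<open>n + 1\<close> to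
  \<open>n + 2\<close>, so that a sum over all naturals starts at the point 1.\<close>

definition trapezoid_error :: "complex \<Rightarrow> nat \<Rightarrow> complex" where
  "trapezoid_error s n =
     (of_nat (Suc n) powr (-s) + of_nat (Suc (Suc n)) powr (-s)) / 2
     - (of_nat (Suc (Suc n)) powr (1 - s) - of_nat (Suc n) powr (1 - s)) / (1 - s)"

definition zeta_trapezoid :: "complex \<Rightarrow> complex" where
  "zeta_trapezoid s = 1 / (s - 1) + 1 / 2 + (\<Sum>n. trapezoid_error s n)"

text \<open>The exponent \<open>- Re s - 2\<close> lies below -1 exactly when
  \<open>Re s > -1\<close>; this decay extends the series of errors beyond the half-plane of the
  Dirichlet series.\<close>

lemma norm_trapezoid_error_le:
  assumes s: "Re s > -1" "s \<noteq> 1"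
  shows "norm (trapezoid_error s n) \<le> norm (s * (s + 1)) / 2 * real (Suc n) powr (- Re s - 2)"
proof -
  define a :: complex where "a = of_nat (Suc n)"
  define b :: complex where "b = of_nat (Suc (Suc n))"
  define B where "B = norm (s * (s + 1)) / 2 * real (Suc n) powr (- Re s - 2)"
  define S where "S = closed_segment a b"
  \<comment> \<open>\<open>G z\<close> is the trapezoidal error on \<open>[a, z]\<close>; it vanishes to second order at \<open>a\<close>, and its
    second derivative is \<open>f''(z) (z - a) / 2\<close> for \<open>f z = z\<^sup>-\<^sup>s\<close>.\<close>
  define G where "G z = (a powr (-s) + z powr (-s)) / 2 * (z - a)
      - (z powr (1 - s) - a powr (1 - s)) / (1 - s)" for z
  define G' where "G' z = (a powr (-s) - z powr (-s)) / 2 - s * z powr (-s - 1) * (z - a) / 2" for z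
  have "B \<ge> 0" by (simp add: B_def)
  have S: "z \<in> \<real>" "Re z \<ge> real (Suc n)" "norm (z - a) \<le> 1" if zS: "z \<in> S" for z
  proof -
    obtain u where u: "0 \<le> u" "u \<le> 1" "z = (1 - u) *\<^sub>R a + u *\<^sub>R b"
      using zS unfolding S_def closed_segment_def by auto
    have z: "z = of_real (real (Suc n) + u)"
      using u(3) by (simp add: a_def b_def scaleR_conv_of_real algebra_simps)
    show "z \<in> \<real>" "Re z \<ge> real (Suc n)" using z u by auto
    have "z - a = of_real u" using z by (simp add: a_def)
    then show "norm (z - a) \<le> 1" using u by simp
  qed
  \<comment> \<open>The segment avoids the branch cut, so complex powers are differentiable along
    it.\<close>
  have nonpos: "z \<notin> \<real>\<^sub>\<le>\<^sub>0" if "z \<in> S" for z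
    using S(2)[OF that] by (simp add: complex_nonpos_Reals_iff)
  have aS: "a \<in> S" and bS: "b \<in> S" and cS: "convex S"
    unfolding S_def by (intro ends_in_segment convex_closed_segment)+
  have dG: "(G has_field_derivative G' z) (at z within S)" if "z \<in> S" for z
  proof -
    have "((\<lambda>z. z powr t) has_field_derivative t * z powr (t - 1)) (at z within S)" for t
      using nonpos[OF that] by (rule has_field_derivative_at_within[OF has_field_derivative_powr])
    then have "(G has_field_derivative
        (0 + - s * z powr (- s - 1)) / 2 * (z - a) + (1 - 0) * ((a powr (-s) + z powr (-s)) / 2)
        - ((1 - s) * z powr (1 - s - 1) - 0) / (1 - s)) (at z within S)"
      unfolding G_def
      by (intro DERIV_diff DERIV_mult DERIV_cdivide DERIV_add DERIV_const DERIV_ident)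
    also have "(0 + - s * z powr (- s - 1)) / 2 * (z - a) + (1 - 0) * ((a powr (-s) + z powr (-s)) / 2)
        - ((1 - s) * z powr (1 - s - 1) - 0) / (1 - s) = G' z"
      using s by (simp add: G'_def)
    finally show ?thesis .
  qed
  have dG': "(G' has_field_derivative (s * (s + 1) * z powr (-s - 2) * (z - a) / 2)) (at z within S)"
    if "z \<in> S" for z
  proof -
    have "((\<lambda>z. z powr t) has_field_derivative t * z powr (t - 1)) (at z within S)" for t
      using nonpos[OF that] by (rule has_field_derivative_at_within[OF has_field_derivative_powr])
    then have "(G' has_field_derivative
        (0 - - s * z powr (- s - 1)) / 2
        - (s * ((- s - 1) * z powr (- s - 1 - 1)) * (z - a) + (1 - 0) * (s * z powr (- s - 1))) / 2) (at z within S)"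
      unfolding G'_def
      by (intro DERIV_diff DERIV_mult DERIV_cmult DERIV_cdivide DERIV_const DERIV_ident)
    also have "(0 - - s * z powr (- s - 1)) / 2
        - (s * ((- s - 1) * z powr (- s - 1 - 1)) * (z - a) + (1 - 0) * (s * z powr (- s - 1))) / 2
        = s * (s + 1) * z powr (-s - 2) * (z - a) / 2"
      by (simp add: diff_divide_distrib add_divide_distrib algebra_simps)
    finally show ?thesis .
  qed
  have dG'_le: "norm (s * (s + 1) * z powr (-s - 2) * (z - a) / 2) \<le> B" if "z \<in> S" for z
  proof -
    have "norm (z powr (-s - 2)) = Re z powr (- Re s - 2)"
      using S[OF that] by (subst norm_powr_real_powr) auto
    also have "\<dots> \<le> real (Suc n) powr (- Re s - 2)"
      using S[OF that] s by (intro powr_mono2') auto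
    finally have "norm (z powr (-s - 2)) * norm (z - a) \<le> real (Suc n) powr (- Re s - 2) * 1"
      using S[OF that] by (intro mult_mono) auto
    then have "norm (s * (s + 1)) / 2 * (norm (z powr (-s - 2)) * norm (z - a))
        \<le> norm (s * (s + 1)) / 2 * (real (Suc n) powr (- Re s - 2) * 1)"
      by (intro mult_left_mono) auto
    then show ?thesis by (simp add: B_def norm_mult norm_divide)
  qed
  have G'_le: "norm (G' z) \<le> B" if "z \<in> S" for z
  proof -
    \<comment> \<open>Since \<open>G' a = 0\<close> and the segment has length 1, the bound on the
      second derivative passes to \<open>G'\<close>, and then in the same way to
      \<open>G\<close>.\<close>
    have "norm (G' z - G' a) \<le> B * norm (z - a)"
      by (rule field_differentiable_bound[OF cS dG' dG'_le that aS])
    also have "\<dots> \<le> B * 1"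
      using S[OF that] \<open>B \<ge> 0\<close> by (intro mult_left_mono) auto
    finally show ?thesis by (simp add: G'_def)
  qed
  have "norm (G b - G a) \<le> B * norm (b - a)"
    by (rule field_differentiable_bound[OF cS dG G'_le bS aS])
  also have "\<dots> \<le> B * 1"
    using S[OF bS] \<open>B \<ge> 0\<close> by (intro mult_left_mono) auto
  also have "G b - G a = trapezoid_error s n"
    by (simp add: G_def trapezoid_error_def a_def b_def)
  finally show ?thesis by (simp add: B_def)
qed

lemma summable_Suc_powr:
  assumes "p < -1"
  shows "summable (\<lambda>n. real (Suc n) powr p)"
  using assms summable_real_powr_iff[of p] by (subst summable_Suc_iff) auto

lemma summable_trapezoid_error:
  assumes "Re s > -1" "s \<noteq> 1"
  shows "summable (trapezoid_error s)"
proof (rule summable_comparison_test')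
  show "summable (\<lambda>n. norm (s * (s + 1)) / 2 * real (Suc n) powr (- Re s - 2))"
    using assms by (intro summable_mult summable_Suc_powr) auto
qed (use norm_trapezoid_error_le[OF assms] in auto)

text \<open>The partial sums are holomorphic, and the Weierstrass M-test gives uniform convergence
  on closed discs.\<close>

lemma holomorphic_zeta_trapezoid: "zeta_trapezoid holomorphic_on ({z. -1 < Re z} - {1})"
proof -
  let ?D = "{z. -1 < Re z} - {1::complex}"
  have D: "open ?D" by (intro open_delete open_halfspace_Re_gt)
  have "(\<lambda>s. \<Sum>n. trapezoid_error s n) holomorphic_on ?D"
  proof (rule holomorphic_uniform_sequence[OF D])
    show "(\<lambda>s. \<Sum>n<N. trapezoid_error s n) holomorphic_on ?D" for N
      unfolding trapezoid_error_def by (auto intro!: holomorphic_intros)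
    fix s assume "s \<in> ?D"
    then obtain d where d: "0 < d" "cball s d \<subseteq> ?D"
      using D open_contains_cball by blast
    \<comment> \<open>The least real part on the disc, attained at \<open>s - of_real d\<close>; it
      controls the decay of the errors uniformly there.\<close>
    define r where "r = Re s - d"
    have "s - of_real d \<in> ?D" using d by (intro subsetD[OF d(2)]) (auto simp: dist_norm)
    then have r: "r > -1" by (simp add: r_def)
    define C where "C = (norm s + d) * (norm s + d + 1) / 2"
    have "uniform_limit (cball s d) (\<lambda>N z. \<Sum>n<N. trapezoid_error z n)
        (\<lambda>z. \<Sum>n. trapezoid_error z n) sequentially"
    proof (rule Weierstrass_m_test)
      show "summable (\<lambda>n. C * real (Suc n) powr (- r - 2))"
        using r by (intro summable_mult summable_Suc_powr) auto
      fix n z assume z: "z \<in> cball s d"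
      have zs: "norm (z - s) \<le> d" using z by (simp add: dist_norm norm_minus_commute)
      have "\<bar>Re (z - s)\<bar> \<le> d" using abs_Re_le_cmod zs order_trans by blast
      then have "r \<le> Re z" by (simp add: r_def)
      have nz: "norm z \<le> norm s + d" using norm_triangle_sub[of z s] zs by linarith
      have "norm (z + 1) \<le> norm s + d + 1" using norm_triangle_ineq[of z 1] nz by simp
      then have "norm (z * (z + 1)) \<le> (norm s + d) * (norm s + d + 1)"
        using nz d by (simp add: norm_mult mult_mono)
      then have "norm (z * (z + 1)) / 2 \<le> C" by (simp add: C_def)
      moreover have "real (Suc n) powr (- Re z - 2) \<le> real (Suc n) powr (- r - 2)"
        using \<open>r \<le> Re z\<close> by (intro powr_mono) auto
      ultimately have "norm (z * (z + 1)) / 2 * real (Suc n) powr (- Re z - 2)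
          \<le> C * real (Suc n) powr (- r - 2)"
        using d by (intro mult_mono) (auto simp: C_def)
      moreover have "Re z > -1" "z \<noteq> 1" using z d by auto
      ultimately show "norm (trapezoid_error z n) \<le> C * real (Suc n) powr (- r - 2)"
        using norm_trapezoid_error_le[of z n] by linarith
    qed
    then show "\<exists>d>0. cball s d \<subseteq> ?D \<and> uniform_limit (cball s d)
        (\<lambda>N z. \<Sum>n<N. trapezoid_error z n) (\<lambda>z. \<Sum>n. trapezoid_error z n) sequentially"
      using d by blast
  qed
  then show ?thesis
    unfolding zeta_trapezoid_def by (auto intro!: holomorphic_intros)
qed

text \<open>Adding the averages counts inner points fully and the two end points by half, while the
  integrals telescope.\<close>

lemma sum_trapezoid_error:
  assumes "s \<noteq> 1"
  shows "(\<Sum>n<N. trapezoid_error s n) = (\<Sum>n<N. 1 / of_nat (Suc n) powr s)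
    - 1 / 2 + of_nat (Suc N) powr (-s) / 2 - (of_nat (Suc N) powr (1 - s) - 1) / (1 - s)"
  using assms
  by (induction N) (auto simp: trapezoid_error_def powr_minus field_simps)

lemma Suc_powr_tendsto_0:
  assumes "Re p < 0"
  shows "(\<lambda>n. of_nat (Suc n) powr p) \<longlonglongrightarrow> 0"
proof -
  have "(\<lambda>n. real (Suc n) powr Re p) \<longlonglongrightarrow> 0"
    using assms by (intro tendsto_neg_powr filterlim_compose[OF filterlim_real_sequentially filterlim_Suc])
  then show ?thesis
    by (subst tendsto_norm_zero_iff[symmetric], subst norm_powr_real_powr) auto
qed

text \<open>For \<open>Re s > 1\<close> the boundary terms at \<open>Suc N\<close> vanish in the
  limit, and the lower end of the integral leaves \<open>1 / (s - 1)\<close>.\<close>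

lemma zeta_trapezoid_sums:
  assumes "Re s > 1"
  shows "(\<lambda>n. 1 / of_nat (Suc n) powr s) sums zeta_trapezoid s"
proof -
  have s: "s \<noteq> 1" using assms by auto
  have "(\<lambda>N. (\<Sum>n<N. trapezoid_error s n) + 1 / 2 - of_nat (Suc N) powr (-s) / 2
      + (of_nat (Suc N) powr (1 - s) - 1) / (1 - s))
    \<longlonglongrightarrow> (\<Sum>n. trapezoid_error s n) + 1 / 2 - 0 / 2 + (0 - 1) / (1 - s)"
    using assms s
    by (intro tendsto_intros Suc_powr_tendsto_0 summable_LIMSEQ summable_trapezoid_error) auto
  also have "(\<Sum>n. trapezoid_error s n) + 1 / 2 - 0 / 2 + (0 - 1) / (1 - s) = zeta_trapezoid s"
    using s by (simp add: zeta_trapezoid_def field_simps)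
  finally show ?thesis
    unfolding sums_def by (simp add: sum_trapezoid_error[OF s])
qed

lemma riemann_zeta_eq_trapezoid:
  assumes "Re s > -1" "s \<noteq> 1"
  shows "riemann_zeta s = zeta_trapezoid s"
  using assms holomorphic_zeta_trapezoid zeta_trapezoid_sums
  by (intro riemann_zeta_eqI[of "-1"]) (auto simp: zeta_continuation_def)

section \<open>Sign of zeta on (-1, 1)\<close>

lemma Re_trapezoid_error:
  "Re (trapezoid_error (of_real s) n) =
     (real (Suc n) powr (-s) + real (Suc (Suc n)) powr (-s)) / 2
     - (real (Suc (Suc n)) powr (1 - s) - real (Suc n) powr (1 - s)) / (1 - s)"
proof -
  have "complex_of_real (real m) powr of_real t = of_real (real m powr t)" for m t
    by (rule powr_of_real) auto
  from this[of _ "-s"] this[of _ "1 - s"]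
  have "(of_nat m :: complex) powr (- of_real s) = of_real (real m powr (-s))"
    "(of_nat m :: complex) powr (1 - of_real s) = of_real (real m powr (1 - s))" for m
    by simp_all
  then have "trapezoid_error (of_real s) n = of_real
     ((real (Suc n) powr (-s) + real (Suc (Suc n)) powr (-s)) / 2
     - (real (Suc (Suc n)) powr (1 - s) - real (Suc n) powr (1 - s)) / (1 - s))"
    unfolding trapezoid_error_def by (simp only:) (simp del: of_nat_Suc)
  then show ?thesis by (simp only: Re_complex_of_real)
qed

text \<open>As \<open>x powr (-s)\<close> decreases, its integral is at least the right end value,
  which the trapezoid exceeds by half the drop.\<close>

lemma Re_trapezoid_error_le_telescope:
  assumes "0 < s" "s < 1"
  shows "Re (trapezoid_error (of_real s) n) \<le>
    (real (Suc n) powr (-s) - real (Suc (Suc n)) powr (-s)) / 2"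
proof -
  have "\<exists>z. real (Suc n) < z \<and> z < real (Suc (Suc n)) \<and>
      real (Suc (Suc n)) powr (1 - s) / (1 - s) - real (Suc n) powr (1 - s) / (1 - s) =
      (real (Suc (Suc n)) - real (Suc n)) * z powr (-s)"
    using assms by (intro MVT2) (auto intro!: derivative_eq_intros)
  then obtain z where z: "real (Suc n) < z" "z < real (Suc (Suc n))"
    "real (Suc (Suc n)) powr (1 - s) / (1 - s) - real (Suc n) powr (1 - s) / (1 - s) = z powr (-s)"
    by auto
  have "z powr (-s) \<ge> real (Suc (Suc n)) powr (-s)"
    using z assms by (intro powr_mono2') auto
  then show ?thesis
    using z(3) unfolding Re_trapezoid_error diff_divide_distrib add_divide_distrib
    by (simp del: of_nat_Suc)
qed

lemma Re_trapezoid_error_nonpos: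
  assumes "-1 < s" "s \<le> 0"
  shows "Re (trapezoid_error (of_real s) n) \<le> 0"
proof -
  define a where "a = real (Suc n)"
  have a: "a > 0" by (simp add: a_def)
  have "s \<noteq> 1" using assms by simp
  \<comment> \<open>The real counterpart of the auxiliary function in
    \<open>norm_trapezoid_error_le\<close>: here the sign of the second derivative matters, not its
    size.\<close>
  define G where "G x = (a powr (-s) + x powr (-s)) / 2 * (x - a)
      - (x powr (1 - s) - a powr (1 - s)) / (1 - s)" for x
  define G' where "G' x = (a powr (-s) - x powr (-s)) / 2 - s * x powr (-s - 1) * (x - a) / 2" for x
  have dG: "(G has_real_derivative G' x) (at x)" if "x \<ge> a" for x
  proof -
    have "((\<lambda>x. x powr t) has_real_derivative t * x powr (t - 1)) (at x)" for t
      using that a by (intro has_real_derivative_powr) auto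
    then have "(G has_real_derivative
        (0 + - s * x powr (- s - 1)) / 2 * (x - a) + (1 - 0) * ((a powr (-s) + x powr (-s)) / 2)
        - ((1 - s) * x powr (1 - s - 1) - 0) / (1 - s)) (at x)"
      unfolding G_def
      by (intro DERIV_diff DERIV_mult DERIV_cdivide DERIV_add DERIV_const DERIV_ident)
    also have "(0 + - s * x powr (- s - 1)) / 2 * (x - a) + (1 - 0) * ((a powr (-s) + x powr (-s)) / 2)
        - ((1 - s) * x powr (1 - s - 1) - 0) / (1 - s) = G' x"
      using \<open>s \<noteq> 1\<close> by (simp add: G'_def)
    finally show ?thesis .
  qed
  have dG': "(G' has_real_derivative (s * (s + 1) * x powr (-s - 2) * (x - a) / 2)) (at x)"
    if "x \<ge> a" for x
  proof -
    have "((\<lambda>x. x powr t) has_real_derivative t * x powr (t - 1)) (at x)" for t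
      using that a by (intro has_real_derivative_powr) auto
    then have "(G' has_real_derivative
        (0 - - s * x powr (- s - 1)) / 2
        - (s * ((- s - 1) * x powr (- s - 1 - 1)) * (x - a) + (1 - 0) * (s * x powr (- s - 1))) / 2) (at x)"
      unfolding G'_def
      by (intro DERIV_diff DERIV_mult DERIV_cmult DERIV_cdivide DERIV_const DERIV_ident)
    also have "(0 - - s * x powr (- s - 1)) / 2
        - (s * ((- s - 1) * x powr (- s - 1 - 1)) * (x - a) + (1 - 0) * (s * x powr (- s - 1))) / 2
        = s * (s + 1) * x powr (-s - 2) * (x - a) / 2"
      by (simp add: diff_divide_distrib add_divide_distrib algebra_simps)
    finally show ?thesis .
  qed
  \<comment> \<open>The sign comes from \<open>s * (s + 1) \<le> 0\<close>, that is, from concavity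
    of \<open>x powr (-s)\<close>.\<close>
  have G''_le: "s * (s + 1) * x powr (-s - 2) * (x - a) / 2 \<le> 0" if "x \<ge> a" for x
    using that assms by (intro divide_nonpos_pos mult_nonpos_nonneg) auto
  have G'_le: "G' x \<le> 0" if "x \<ge> a" for x
  proof -
    have "G' x \<le> G' a"
      using dG' G''_le by (intro DERIV_nonpos_imp_nonincreasing[OF that]) blast
    then show ?thesis by (simp add: G'_def)
  qed
  have "G (a + 1) \<le> G a"
  proof (rule DERIV_nonpos_imp_nonincreasing[where f = G])
    show "\<exists>y. (G has_real_derivative y) (at x) \<and> y \<le> 0" if "a \<le> x" "x \<le> a + 1" for x
      using dG[OF that(1)] G'_le[OF that(1)] by blast
  qed simp
  then show ?thesis
    by (simp add: G_def Re_trapezoid_error a_def add.commute)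
qed

lemma real_zeta_neg:
  assumes "-1 < s" "s < 1"
  shows "real_zeta s < 0"
proof -
  define E where "E n = Re (trapezoid_error (of_real s) n)" for n
  have ne: "complex_of_real s \<noteq> 1" using assms by (simp add: complex_eq_iff)
  have "summable (trapezoid_error (of_real s))"
    using assms ne by (intro summable_trapezoid_error) auto
  then have E: "summable E" "Re (\<Sum>n. trapezoid_error (of_real s) n) = (\<Sum>n. E n)"
    unfolding E_def by (auto intro: summable_Re simp: Re_suminf)
  have "1 / (complex_of_real s - 1) = of_real (1 / (s - 1))" by simp
  then have "Re (1 / (complex_of_real s - 1)) = 1 / (s - 1)" by (simp only: Re_complex_of_real)
  then have zeta: "real_zeta s = 1 / (s - 1) + 1 / 2 + (\<Sum>n. E n)"
    using assms ne E(2)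
    by (simp add: real_zeta_def riemann_zeta_eq_trapezoid zeta_trapezoid_def)
  show ?thesis
  proof (cases "s > 0")
    case True
    have "(\<Sum>n<N. E n) \<le> 1 / 2" for N
    proof -
      have "(\<Sum>n<N. E n) \<le> (\<Sum>n<N. (real (Suc n) powr (-s) - real (Suc (Suc n)) powr (-s)) / 2)"
        unfolding E_def using True assms by (intro sum_mono Re_trapezoid_error_le_telescope) auto
      also have "\<dots> = (1 - real (Suc N) powr (-s)) / 2"
        by (induction N) (auto simp: field_simps)
      also have "\<dots> \<le> 1 / 2" by simp
      finally show ?thesis .
    qed
    then have "(\<Sum>n. E n) \<le> 1 / 2" by (rule suminf_le_const[OF E(1)])
    \<comment> \<open>The two halves add up to 1, and
      \<open>1 / (s - 1) + 1 = s / (s - 1)\<close>.\<close>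
    moreover have "1 / (s - 1) + 1 < 0" using True assms by (simp add: field_simps)
    ultimately show ?thesis using zeta by linarith
  next
    case False
    have "(\<Sum>n<N. E n) \<le> 0" for N
      unfolding E_def using False assms by (intro sum_nonpos Re_trapezoid_error_nonpos) auto
    then have "(\<Sum>n. E n) \<le> 0" by (rule suminf_le_const[OF E(1)])
    \<comment> \<open>Equivalent to \<open>s > -1\<close> for \<open>s < 1\<close>.\<close>
    moreover have "1 / (s - 1) + 1 / 2 < 0" using assms by (simp add: field_simps)
    ultimately show ?thesis using zeta by linarith
  qed
qed

section \<open>Bounds for the nonlocal sum\<close>

text \<open>Integral comparison: the first term is 1, and the others are dominated by the integral
  of \<open>x powr (- 1 - \<alpha>)\<close> over x > 1, which is
  \<open>1 / \<alpha>\<close>.\<close>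

lemma sum_powr_le:
  assumes "0 < \<alpha>"
  shows "(\<Sum>k<N. real (Suc k) powr (- 1 - \<alpha>)) \<le> 1 + 1 / \<alpha>"
proof -
  have step: "real (Suc (Suc k)) powr (- 1 - \<alpha>)
      \<le> real (Suc k) powr (- \<alpha>) / \<alpha> - real (Suc (Suc k)) powr (- \<alpha>) / \<alpha>" for k
  proof -
    have "\<exists>z. real (Suc k) < z \<and> z < real (Suc (Suc k)) \<and>
        - (real (Suc (Suc k)) powr (- \<alpha>) / \<alpha>) - - (real (Suc k) powr (- \<alpha>) / \<alpha>) =
        (real (Suc (Suc k)) - real (Suc k)) * z powr (- 1 - \<alpha>)"
      using assms by (intro MVT2) (auto intro!: derivative_eq_intros simp: minus_diff_commute)
    then obtain z where z: "real (Suc k) < z" "z < real (Suc (Suc k))"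
      "real (Suc k) powr (- \<alpha>) / \<alpha> - real (Suc (Suc k)) powr (- \<alpha>) / \<alpha> = z powr (- 1 - \<alpha>)"
      by auto
    then show ?thesis using assms by (auto simp del: of_nat_Suc intro!: powr_mono2')
  qed
  \<comment> \<open>Keeping the tail of the integral in the bound makes the induction go
    through.\<close>
  have "(\<Sum>k<Suc m. real (Suc k) powr (- 1 - \<alpha>))
      \<le> 1 + 1 / \<alpha> - real (Suc m) powr (- \<alpha>) / \<alpha>" for m
  proof (induction m)
    case (Suc m)
    then show ?case using step[of m] by (subst sum.lessThan_Suc) linarith
  qed simp
  then have "(\<Sum>k<Suc m. real (Suc k) powr (- 1 - \<alpha>)) \<le> 1 + 1 / \<alpha>" for m
    by (rule order_trans) (use assms in auto)
  then show ?thesis using assms by (cases N) auto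
qed

lemma sum_symmetric_int:
  fixes f :: "int \<Rightarrow> real"
  shows "(\<Sum>k \<in> {- int N..int N} - {0}. f \<bar>k\<bar>) = 2 * (\<Sum>k<N. f (int (Suc k)))"
proof (induction N)
  case (Suc N)
  have "{- int (Suc N)..int (Suc N)} - {0} =
      insert (int (Suc N)) (insert (- int (Suc N)) ({- int N..int N} - {0}))"
    by auto
  then show ?case using Suc by (simp add: algebra_simps)
qed auto

lemma levy_const_pos:
  assumes "0 < \<alpha>" "\<alpha> < 2"
  shows "levy_const \<alpha> > 0"
  unfolding levy_const_def using assms
  by (intro divide_pos_pos mult_pos_pos Gamma_real_pos) auto

text \<open>Replacing every neighbour value by \<open>M\<close> leaves the gap
  \<open>M - V j\<close> times the total weight, which the series bound controls on both sides of
  \<open>j\<close>.\<close>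

lemma nonlocal_sum_le:
  assumes "0 < \<alpha>" "0 < h" "\<bar>j\<bar> \<le> int J"
    and V: "\<And>i. \<bar>i\<bar> \<le> int J \<Longrightarrow> V i \<le> M"
  shows "h * nonlocal_sum \<alpha> h J V j \<le> h powr (- \<alpha>) * (2 * (1 + 1 / \<alpha>)) * (M - V j)"
proof -
  let ?K = "{- int J - j..int J - j} - {0}"
  define p where "p k = real_of_int k powr (- 1 - \<alpha>)" for k
  have Vj: "V j \<le> M" using assms by auto
  have "nonlocal_sum \<alpha> h J V j \<le> (\<Sum>k\<in>?K. h powr (- 1 - \<alpha>) * (M - V j) * p \<bar>k\<bar>)"
    unfolding nonlocal_sum_def
  proof (rule sum_mono)
    fix k assume k: "k \<in> ?K"
    have "\<bar>grid h k\<bar> powr (1 + \<alpha>) = h powr (1 + \<alpha>) * real_of_int \<bar>k\<bar> powr (1 + \<alpha>)"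
      using assms by (simp add: grid_def abs_mult powr_mult)
    also have "1 / \<dots> = h powr (- 1 - \<alpha>) * p \<bar>k\<bar>"
      using powr_minus_divide[of h "1 + \<alpha>"] powr_minus_divide[of "real_of_int \<bar>k\<bar>" "1 + \<alpha>"]
      by (simp add: p_def)
    finally have w: "x / \<bar>grid h k\<bar> powr (1 + \<alpha>) = h powr (- 1 - \<alpha>) * p \<bar>k\<bar> * x" for x
      by (metis mult.commute mult_1_right times_divide_eq_right)
    have "V (j + k) \<le> M" using k by (intro V) auto
    then have "h powr (- 1 - \<alpha>) * p \<bar>k\<bar> * (V (j + k) - V j) \<le> h powr (- 1 - \<alpha>) * p \<bar>k\<bar> * (M - V j)"
      by (intro mult_left_mono) (auto simp: p_def)
    \<comment> \<open>Nonnegativity lets the end weights 1/2 be raised to 1.\<close>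
    moreover have "0 \<le> h powr (- 1 - \<alpha>) * p \<bar>k\<bar> * (M - V j)"
      using Vj by (auto simp: p_def)
    ultimately show "(if k = - int J - j \<or> k = int J - j then 1 / 2 else 1) *
        ((V (j + k) - V j) / \<bar>grid h k\<bar> powr (1 + \<alpha>)) \<le> h powr (- 1 - \<alpha>) * (M - V j) * p \<bar>k\<bar>"
      unfolding w by (auto simp: mult_ac)
  qed
  also have "\<dots> = h powr (- 1 - \<alpha>) * (M - V j) * (\<Sum>k\<in>?K. p \<bar>k\<bar>)"
    by (simp only: sum_distrib_left)
  also have "\<dots> \<le> h powr (- 1 - \<alpha>) * (M - V j) * (2 * (1 + 1 / \<alpha>))"
  proof (intro mult_left_mono)
    \<comment> \<open>The offsets are not symmetric around 0, but
      \<open>\<bar>j\<bar> \<le> int J\<close> puts them within distance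
      \<open>2 * J\<close>.\<close>
    have "(\<Sum>k\<in>?K. p \<bar>k\<bar>) \<le> (\<Sum>k\<in>{- int (2 * J)..int (2 * J)} - {0}. p \<bar>k\<bar>)"
      using assms by (intro sum_mono2) (auto simp: p_def)
    also have "\<dots> = 2 * (\<Sum>k<2 * J. real (Suc k) powr (- 1 - \<alpha>))"
      unfolding sum_symmetric_int by (simp add: p_def)
    also have "\<dots> \<le> 2 * (1 + 1 / \<alpha>)"
      using sum_powr_le[OF assms(1)] by (intro mult_left_mono) auto
    finally show "(\<Sum>k\<in>?K. p \<bar>k\<bar>) \<le> 2 * (1 + 1 / \<alpha>)" .
  qed (use Vj in auto)
  finally have "h * nonlocal_sum \<alpha> h J V j
      \<le> h * (h powr (- 1 - \<alpha>) * (M - V j) * (2 * (1 + 1 / \<alpha>)))"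
    using assms(2) by (intro mult_left_mono) auto
  also have "\<dots> = (h * h powr (- 1 - \<alpha>)) * (2 * (1 + 1 / \<alpha>)) * (M - V j)"
    by (simp only: mult_ac)
  also have "h * h powr (- 1 - \<alpha>) = h powr (- \<alpha>)"
    using assms(2) powr_add[of h 1 "- 1 - \<alpha>"] by simp
  finally show ?thesis .
qed

section \<open>The discrete maximum principle\<close>

theorem proposition3p2:
  fixes \<alpha> Mt L h dt M :: real
    and \<sigma> :: "real \<Rightarrow> real"
    and J :: nat
    and U :: "nat \<Rightarrow> int \<Rightarrow> real"
  assumes "0 < \<alpha>" and "\<alpha> < 2"
    and "twice_cont_diff (\<lambda>x. \<bar>\<sigma> x\<bar> powr \<alpha>)"
    and "\<And>x. \<sigma> x \<noteq> 0"
    and "\<And>x. \<bar>\<sigma> x\<bar> \<le> Mt"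
    and "1 < L"
    and "0 < h"
    and "real J = L / h"
    and "0 < dt"
    and "explicit_euler_scheme \<alpha> \<sigma> h dt J U"
    and "dt / h powr \<alpha> \<le>
           1 / (2 * Mt powr \<alpha> * levy_const \<alpha> * (1 + 1 / \<alpha> - real_zeta (\<alpha> - 1)))"
    and "M = Max (U 0 ` {- int J .. int J})"
  shows "\<forall>n. (\<forall>j. \<bar>j\<bar> \<le> int J \<longrightarrow> 0 < U n j \<and> U n j \<le> M) \<longrightarrow>
             (\<forall>j. \<bar>j\<bar> < int J \<longrightarrow> U (Suc n) j \<le> M)"
proof (intro allI impI)
  fix n j
  assume "\<forall>j. \<bar>j\<bar> \<le> int J \<longrightarrow> 0 < U n j \<and> U n j \<le> M" and j: "\<bar>j\<bar> < int J"
  then have V: "U n i \<le> M" if "\<bar>i\<bar> \<le> int J" for i using that by blast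
  define c where "c = levy_coeff \<alpha> \<sigma> (grid h j)"
  define Z where "Z = - real_zeta (\<alpha> - 1)"
  \<comment> \<open>With \<open>T\<close> the bracket of the step size restriction,
    \<open>A * (2 * T)\<close> bounds the total weight of the other grid points:
    \<open>2 * A * Z\<close> from the second difference, the rest from the nonlocal sum.\<close>
  define A where "A = dt * c * h powr (- \<alpha>)"
  define T where "T = 1 + 1 / \<alpha> + Z"
  have Z: "Z > 0" using real_zeta_neg[of "\<alpha> - 1"] assms by (simp add: Z_def)
  have T: "T > 0" unfolding T_def using Z assms by (intro add_pos_pos) auto
  \<comment> \<open>Any point would do; strict positivity allows \<open>Mt powr \<alpha>\<close> to
    be cancelled below.\<close>
  have Mt: "Mt > 0" using assms(4,5)[of 0] by linarith
  note levy = levy_const_pos[OF assms(1,2)]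
  have c: "0 \<le> c" "c \<le> levy_const \<alpha> * Mt powr \<alpha>"
    unfolding c_def levy_coeff_def using assms(1,5) levy
    by (auto intro!: mult_left_mono powr_mono2)
  have A: "A \<ge> 0" using c assms by (simp add: A_def)
  have "A = dt / h powr \<alpha> * c" by (simp add: A_def powr_minus_divide)
  also have "\<dots> \<le> 1 / (2 * Mt powr \<alpha> * levy_const \<alpha> * T) * (levy_const \<alpha> * Mt powr \<alpha>)"
    using assms(9,11) c T levy by (intro mult_mono) (auto simp: T_def Z_def)
  also have "\<dots> = 1 / (2 * T)" using Mt levy T by (simp add: field_simps)
  finally have AT: "A * (2 * T) \<le> 1" using T by (simp add: field_simps)
  have eq: "U (Suc n) j = U n j - dt * c * real_zeta (\<alpha> - 1) * h powr (- \<alpha>)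
      * (U n (j + 1) - 2 * U n j + U n (j - 1)) + c * dt * h * nonlocal_sum \<alpha> h J (U n) j"
    using assms(10) j unfolding explicit_euler_scheme_def c_def by blast
  have "U (Suc n) j = U n j + A * Z * (U n (j + 1) - 2 * U n j + U n (j - 1))
      + dt * c * (h * nonlocal_sum \<alpha> h J (U n) j)"
    unfolding eq Z_def A_def by (simp add: algebra_simps)
  \<comment> \<open>Both coefficients are nonnegative, so all other values may be raised to
    \<open>M\<close>.\<close>
  also have "\<dots> \<le> U n j + A * Z * (2 * (M - U n j))
      + dt * c * (h powr (- \<alpha>) * (2 * (1 + 1 / \<alpha>)) * (M - U n j))"
  proof (intro add_mono mult_left_mono order_refl)
    have "U n (j + 1) \<le> M" "U n (j - 1) \<le> M" using j by (auto intro!: V)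
    then show "U n (j + 1) - 2 * U n j + U n (j - 1) \<le> 2 * (M - U n j)" by simp
    show "h * nonlocal_sum \<alpha> h J (U n) j \<le> h powr (- \<alpha>) * (2 * (1 + 1 / \<alpha>)) * (M - U n j)"
      using assms(1,7) j V by (intro nonlocal_sum_le) auto
  qed (use A Z c assms in auto)
  also have "\<dots> = U n j + A * (2 * T) * (M - U n j)"
    by (simp add: A_def T_def algebra_simps)
  \<comment> \<open>The increment is at most the whole gap to \<open>M\<close>.\<close>
  also have "\<dots> \<le> U n j + 1 * (M - U n j)"
    using AT V[of j] j by (intro add_left_mono mult_right_mono) auto
  finally show "U (Suc n) j \<le> M" by simp
qed

end
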